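(* Let $G_1$ and $G_2$ be simple connected graphs, each with at least one edge, and let $G=G_1\oplus_v G_2$ be their 1-sum, in which a vertex of $G_1$ and a vertex of $G_2$ are identified into the single vertex $v$. Let $m_1=|E(G_1)|$, $m_2=|E(G_2)|$, so that $|E(G)|=m_1+m_2$. Then $$\mathscr{K}(G)=\frac{m_1\left(\mathscr{K}(G_1)+\mu(G_2,v)\right)+m_2\left(\mathscr{K}(G_2)+\mu(G_1,v)\right)}{m_1+m_2}.$$
   Context: All graphs are finite, simple, undirected. For a connected graph $H$ with Laplacian $L$, the effective resistance between vertices $i,j$ is $r_H(i,j)=(e_i-e_j)^TL^\dagger(e_i-e_j)$, where $L^\dagger$ is the Moore–Penrose pseudoinverse and $e_i$ the $i$-th standard basis vector (equivalently, the resistance between $i$ and $j$ when each edge is a unit resistor). For a connected graph $H$ with $m\ge1$ edges and degrees $d_i$, Kemeny's constant is $\mathscr{K}(H)=\sum_j \pi_j m_{ij}$ for the simple random walk on $H$, where $\pi_j=d_j/(2m)$ and $m_{ij}$ is the expected hitting time of $j$ from $i$ (with $m_{jj}=0$); it equals $\frac{1}{4m}\sum_{i,j\in V(H)} d_id_j r_H(i,j)$. The moment of a vertex $v$ of $H$ is $\mu(H,v)=\sum_{i\in V(H)} d_i\, r_H(i,v)$. The 1-sum $G_1\oplus_{v_1,v_2}G_2$ of graphs $G_1,G_2$ at vertices $v_1\in V(G_1)$, $v_2\in V(G_2)$ is obtained from the disjoint union of $G_1$ and $G_2$ by identifying $v_1$ and $v_2$ into a single vertex $v$; in $\mu(G_1,v)$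 and $\mu(G_2,v)$, $v$ denotes this vertex viewed in $G_1$ resp. $G_2$. *)

theory Defs
  imports "HOL-Probability.Probability_Mass_Function"
begin

record 'a ugraph =
  verts :: "'a set"
  edges :: "'a set set"

definition simple_graph :: "'a ugraph \<Rightarrow> bool" where
  "simple_graph H \<longleftrightarrow>
     finite (verts H) \<and> (\<forall>e\<in>edges H. e \<subseteq> verts H \<and> card e = 2)"

definition adjacency :: "'a ugraph \<Rightarrow> ('a \<times> 'a) set" where
  "adjacency H = {(i, j). {i, j} \<in> edges H}"

definition connected_graph :: "'a ugraph \<Rightarrow> bool" where
  "connected_graph H \<longleftrightarrow>
     verts H \<noteq> {} \<and> (\<forall>i\<in>verts H. \<forall>j\<in>verts H. (i, j) \<in> (adjacency H)\<^sup>*)"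

definition neighbors :: "'a ugraph \<Rightarrow> 'a \<Rightarrow> 'a set" where
  "neighbors H i = {j. {i, j} \<in> edges H}"

definition degree :: "'a ugraph \<Rightarrow> 'a \<Rightarrow> nat" where
  "degree H i = card (neighbors H i)"

text \<open>
  Square matrices with rows and columns indexed by a finite set \<open>I\<close> are functions
  \<open>'a \<Rightarrow> 'a \<Rightarrow> real\<close>, considered on \<open>I \<times> I\<close> only.
\<close>

definition mat_prod :: "'a set \<Rightarrow> ('a \<Rightarrow> 'a \<Rightarrow> real) \<Rightarrow> ('a \<Rightarrow> 'a \<Rightarrow> real) \<Rightarrow> 'a \<Rightarrow> 'a \<Rightarrow> real"
  where "mat_prod I A B = (\<lambda>i j. \<Sum>k\<in>I. A i k * B k j)"

text \<open>
  The four Penrose conditions.  The requirement that \<open>X\<close> vanish outside \<open>I \<times> I\<close> only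
  serves to make \<open>X\<close> unique as a function on the whole type.
\<close>

definition is_pseudoinverse :: "'a set \<Rightarrow> ('a \<Rightarrow> 'a \<Rightarrow> real) \<Rightarrow> ('a \<Rightarrow> 'a \<Rightarrow> real) \<Rightarrow> bool"
  where
  "is_pseudoinverse I A X \<longleftrightarrow>
     (\<forall>i j. i \<notin> I \<or> j \<notin> I \<longrightarrow> X i j = 0) \<and>
     (\<forall>i\<in>I. \<forall>j\<in>I.
        mat_prod I (mat_prod I A X) A i j = A i j \<and>
        mat_prod I (mat_prod I X A) X i j = X i j \<and>
        mat_prod I A X i j = mat_prod I A X j i \<and>
        mat_prod I X A i j = mat_prod I X A j i)"

definition pseudoinverse :: "'a set \<Rightarrow> ('a \<Rightarrow> 'a \<Rightarrow> real) \<Rightarrow> 'a \<Rightarrow> 'a \<Rightarrow> real" where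
  "pseudoinverse I A = (THE X. is_pseudoinverse I A X)"

definition laplacian :: "'a ugraph \<Rightarrow> 'a \<Rightarrow> 'a \<Rightarrow> real" where
  "laplacian H i j =
     (if i = j then real (degree H i) else if {i, j} \<in> edges H then - 1 else 0)"

definition unit_vec :: "'a \<Rightarrow> 'a \<Rightarrow> real" where
  "unit_vec i k = (if k = i then 1 else 0)"

definition resistance :: "'a ugraph \<Rightarrow> 'a \<Rightarrow> 'a \<Rightarrow> real" where
  "resistance H i j =
     (\<Sum>k\<in>verts H. \<Sum>l\<in>verts H.
        (unit_vec i k - unit_vec j k) * pseudoinverse (verts H) (laplacian H) k l *
        (unit_vec i l - unit_vec j l))"

definition moment :: "'a ugraph \<Rightarrow> 'a \<Rightarrow> real" where
  "moment H v = (\<Sum>i\<in>verts H. real (degree H i) * resistance H i v)"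

text \<open>
  \<open>random_walk H i n\<close> is the law of the trajectory \<open>[X\<^sub>0, \<dots>, X\<^sub>n]\<close> of the simple random
  walk on \<open>H\<close> started at \<open>X\<^sub>0 = i\<close>.  It is meaningful if no vertex of \<open>H\<close> is isolated.
\<close>

primrec random_walk :: "'a ugraph \<Rightarrow> 'a \<Rightarrow> nat \<Rightarrow> 'a list pmf" where
  "random_walk H i 0 = return_pmf [i]"
| "random_walk H i (Suc n) =
     bind_pmf (pmf_of_set (neighbors H i)) (\<lambda>k. map_pmf ((#) i) (random_walk H k n))"

text \<open>The probability that the walk started at \<open>i\<close> visits \<open>j\<close> for the first time at time \<open>n\<close>.\<close>

definition hitting_prob :: "'a ugraph \<Rightarrow> 'a \<Rightarrow> 'a \<Rightarrow> nat \<Rightarrow> real" where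
  "hitting_prob H i j n =
     measure_pmf.prob (random_walk H i n) {xs. xs ! n = j \<and> (\<forall>k<n. xs ! k \<noteq> j)}"

text \<open>
  The expectation of the hitting time.  In a finite connected graph the hitting time is almost
  surely finite with finite mean, so that its expectation is this convergent series.
\<close>

definition hitting_time :: "'a ugraph \<Rightarrow> 'a \<Rightarrow> 'a \<Rightarrow> real" where
  "hitting_time H i j = (\<Sum>n. real n * hitting_prob H i j n)"

definition stationary :: "'a ugraph \<Rightarrow> 'a \<Rightarrow> real" where
  "stationary H j = real (degree H j) / (2 * real (card (edges H)))"

text \<open>
  Kemeny's constant is the common value, over all starting vertices \<open>i\<close>, of the expected time to
  reach a vertex drawn from the stationary distribution.
\<close>

definition kemeny :: "'a ugraph \<Rightarrow> real" where
  "kemeny H =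
     (THE c. \<forall>i\<in>verts H. c = (\<Sum>j\<in>verts H. stationary H j * hitting_time H i j))"

text \<open>
  The 1-sum lives on the sum type: \<open>Inl v\<^sub>1\<close> is the merged vertex, and \<open>Inr v\<^sub>2\<close> is not used.
\<close>

definition glue :: "'a \<Rightarrow> 'b \<Rightarrow> 'b \<Rightarrow> 'a + 'b" where
  "glue v\<^sub>1 v\<^sub>2 x = (if x = v\<^sub>2 then Inl v\<^sub>1 else Inr x)"

definition one_sum :: "'a ugraph \<Rightarrow> 'a \<Rightarrow> 'b \<Rightarrow> 'b ugraph \<Rightarrow> ('a + 'b) ugraph" where
  "one_sum G\<^sub>1 v\<^sub>1 v\<^sub>2 G\<^sub>2 =
     \<lparr> verts = Inl ` verts G\<^sub>1 \<union> glue v\<^sub>1 v\<^sub>2 ` verts G\<^sub>2,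
       edges = (`) Inl ` edges G\<^sub>1 \<union> (`) (glue v\<^sub>1 v\<^sub>2) ` edges G\<^sub>2 \<rparr>"

end

theory Submission imports Defs begin

text \<open>
  Write \<open>h\<^sub>j\<close> for the expected hitting time of \<open>j\<close> as a function of the starting vertex.  It is the
  unique function vanishing at \<open>j\<close> whose image under the Laplacian is \<open>d - 2m e\<^sub>j\<close>.  Therefore
  \<open>(h\<^sub>j - h\<^sub>i)/2m\<close> is a potential for the unit current from \<open>i\<close> to \<open>j\<close>, which yields the commute time
  identity \<open>2m r(i,j) = h\<^sub>j(i) + h\<^sub>i(j)\<close>, the pseudoinverse of the Laplacian, and the fact that
  \<open>\<Sum>\<^sub>j \<pi>\<^sub>j h\<^sub>j\<close> is harmonic and hence constant.  In a 1-sum at \<open>v\<close>, the same uniqueness shows for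
  \<open>j\<close> in the first summand that the hitting time of \<open>j\<close> from \<open>v\<close> is \<open>h\<^sub>j(v) + 2m\<^sub>2 r(j,v)\<close>, with both
  terms computed in the first summand.  Averaging this over \<open>j\<close> with weights \<open>d\<^sub>j\<close> gives the theorem.
\<close>

section \<open>The Laplacian operator\<close>

text \<open>The product of \<open>laplacian H\<close> with a vector, written over neighbours only:
  in this form it splits additively when graphs share a vertex. \<open>lap_laplacian\<close> links
  it to the matrix.\<close>

definition lap :: "'a ugraph \<Rightarrow> ('a \<Rightarrow> real) \<Rightarrow> 'a \<Rightarrow> real" where
  "lap H u i = (\<Sum>k\<in>neighbors H i. u i - u k)"

section \<open>Matrix products and uniqueness of the pseudoinverse\<close>

lemma mat_prod_assoc:
  "mat_prod I (mat_prod I A B) C = mat_prod I A (mat_prod I B C)"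
  unfolding mat_prod_def
  by (subst sum_distrib_left, subst sum_distrib_right, subst sum.swap) (simp add: mult.assoc)

lemma mat_prod_cong:
  assumes "\<And>k. k \<in> I \<Longrightarrow> A i k = A' i k" and "\<And>k. k \<in> I \<Longrightarrow> B k j = B' k j"
  shows "mat_prod I A B i j = mat_prod I A' B' i j"
  unfolding mat_prod_def using assms by (intro sum.cong) auto

lemma mat_prod_transpose:
  "mat_prod I (\<lambda>i j. B j i) (\<lambda>i j. A j i) i j = mat_prod I A B j i"
  unfolding mat_prod_def by (simp add: mult.commute)

text \<open>Penrose's argument: transposing gives \<open>AX = AYAX = (AXAY)^T = (AY)^T = AY\<close>,
  likewise \<open>XA = YA\<close>, and then \<open>X = XAX = XAY = YAY = Y\<close>.\<close>

lemma is_pseudoinverse_unique: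
  assumes X: "is_pseudoinverse I A X" and Y: "is_pseudoinverse I A Y"
  shows "X = Y"
proof -
  let ?P = "mat_prod I"
  have X1: "?P (?P A X) A i j = A i j" and X2: "?P (?P X A) X i j = X i j"
    and X3: "?P A X i j = ?P A X j i" and X4: "?P X A i j = ?P X A j i"
    and Y1: "?P (?P A Y) A i j = A i j" and Y2: "?P (?P Y A) Y i j = Y i j"
    and Y3: "?P A Y i j = ?P A Y j i" and Y4: "?P Y A i j = ?P Y A j i"
    if "i \<in> I" "j \<in> I" for i j
    using X Y that unfolding is_pseudoinverse_def by blast+
  have AX: "?P A X i j = ?P A Y i j" if ij: "i \<in> I" "j \<in> I" for i j
  proof -
    have "?P A X i j = ?P (?P (?P A Y) A) X i j"
      using ij by (intro mat_prod_cong) (auto simp: Y1)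
    also have "\<dots> = ?P (?P A Y) (?P A X) i j" by (simp add: mat_prod_assoc)
    also have "\<dots> = ?P (\<lambda>i j. ?P A Y j i) (\<lambda>i j. ?P A X j i) i j"
      using ij X3 Y3 by (intro mat_prod_cong) blast+
    also have "\<dots> = ?P (?P A X) (?P A Y) j i" by (rule mat_prod_transpose)
    also have "\<dots> = ?P (?P (?P A X) A) Y j i" by (simp add: mat_prod_assoc)
    also have "\<dots> = ?P A Y j i" using ij by (intro mat_prod_cong) (auto simp: X1)
    also have "\<dots> = ?P A Y i j" using ij Y3 by blast
    finally show ?thesis .
  qed
  have XA: "?P X A i j = ?P Y A i j" if ij: "i \<in> I" "j \<in> I" for i j
  proof -
    have "?P X A i j = ?P X (?P (?P A Y) A) i j"
      using ij by (intro mat_prod_cong) (auto simp: Y1)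
    also have "\<dots> = ?P (?P X A) (?P Y A) i j" by (simp add: mat_prod_assoc)
    also have "\<dots> = ?P (\<lambda>i j. ?P X A j i) (\<lambda>i j. ?P Y A j i) i j"
      using ij X4 Y4 by (intro mat_prod_cong) blast+
    also have "\<dots> = ?P (?P Y A) (?P X A) j i" by (rule mat_prod_transpose)
    also have "\<dots> = ?P Y (?P (?P A X) A) j i" by (simp add: mat_prod_assoc)
    also have "\<dots> = ?P Y A j i" using ij by (intro mat_prod_cong) (auto simp: X1)
    also have "\<dots> = ?P Y A i j" using ij Y4 by blast
    finally show ?thesis .
  qed
  show "X = Y"
  proof (intro ext)
    fix i j
    show "X i j = Y i j"
    proof (cases "i \<in> I \<and> j \<in> I")
      case True
      then have ij: "i \<in> I" "j \<in> I" by auto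
      have "X i j = ?P X (?P A X) i j" using X2[OF ij] by (simp add: mat_prod_assoc)
      also have "\<dots> = ?P X (?P A Y) i j" using ij by - (rule mat_prod_cong, auto simp: AX)
      also have "\<dots> = ?P (?P X A) Y i j" by (simp add: mat_prod_assoc)
      also have "\<dots> = ?P (?P Y A) Y i j" using ij by - (rule mat_prod_cong, auto simp: XA)
      also have "\<dots> = Y i j" using Y2[OF ij] .
      finally show ?thesis .
    next
      case False
      then show ?thesis using X Y unfolding is_pseudoinverse_def by metis
    qed
  qed
qed

lemma pseudoinverse_eqI: "is_pseudoinverse I A X \<Longrightarrow> pseudoinverse I A = X"
  unfolding pseudoinverse_def using is_pseudoinverse_unique by blast

lemma sum_unit_vec:
  assumes "finite A" "i \<in> A"
  shows "(\<Sum>k\<in>A. unit_vec i k * f k) = f i"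
  using assms by (simp add: unit_vec_def if_distrib[of "\<lambda>x. x * _"] cong: if_cong)

section \<open>Degrees and paths in a connected graph with an edge\<close>

locale nontrivial_graph =
  fixes H :: "'a ugraph"
  assumes simple: "simple_graph H" and connected: "connected_graph H" and edge: "edges H \<noteq> {}"
begin

abbreviation "V \<equiv> verts H"
abbreviation "deg i \<equiv> real (degree H i)"
abbreviation "m \<equiv> real (card (edges H))"
abbreviation "ht j i \<equiv> hitting_time H i j"

lemma finite_verts: "finite V" and edge_subset: "e \<in> edges H \<Longrightarrow> e \<subseteq> V"
  and edge_card: "e \<in> edges H \<Longrightarrow> card e = 2"
  using simple unfolding simple_graph_def by auto

lemma finite_edges: "finite (edges H)"
  using finite_verts edge_subset by (meson PowI finite_Pow_iff finite_subset subsetI)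

lemma m_pos: "m > 0"
  using finite_edges edge by (simp add: card_gt_0_iff)

lemma neighbors_subset: "neighbors H i \<subseteq> V"
  unfolding neighbors_def using edge_subset by blast

lemma finite_neighbors: "finite (neighbors H i)"
  using neighbors_subset finite_verts finite_subset by blast

lemma neighbors_irrefl: "i \<notin> neighbors H i"
  unfolding neighbors_def using edge_card by fastforce

lemma neighbors_sym: "k \<in> neighbors H i \<longleftrightarrow> i \<in> neighbors H k"
  unfolding neighbors_def by (simp add: insert_commute)

lemma edge_image_iff:
  assumes f: "inj_on f V" and x: "x \<in> V"
  shows "{f x, y} \<in> (`) f ` edges H \<longleftrightarrow> y \<in> f ` neighbors H x"
proof
  assume "{f x, y} \<in> (`) f ` edges H"
  then obtain e where e: "e \<in> edges H" "{f x, y} = f ` e" by auto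
  obtain a b where ab: "e = {a, b}" using edge_card[OF e(1)] card_2_iff by metis
  have V: "a \<in> V" "b \<in> V" using edge_subset[OF e(1)] ab by auto
  consider "f x = f a" "y = f b" | "f x = f b" "y = f a"
    using e(2) by (auto simp: ab doubleton_eq_iff)
  then show "y \<in> f ` neighbors H x"
  proof cases
    case 1
    then have "x = a" using inj_onD[OF f] x V by blast
    then show ?thesis using 1 e(1) ab by (simp add: neighbors_def)
  next
    case 2
    then have "x = b" using inj_onD[OF f] x V by blast
    then show ?thesis using 2 e(1) ab by (simp add: neighbors_def insert_commute)
  qed
next
  assume "y \<in> f ` neighbors H x"
  then obtain k where k: "{x, k} \<in> edges H" "y = f k" by (auto simp: neighbors_def)
  then have "{f x, y} = f ` {x, k}" by simp
  then show "{f x, y} \<in> (`) f ` edges H" using k(1) by blast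
qed

text \<open>Connectedness as an induction rule: a property of \<open>j\<close> spreads from each
  vertex to its neighbours, back along a path from \<open>i\<close>.\<close>

lemma connected_induct [consumes 2, case_names base step]:
  assumes "i \<in> V" "j \<in> V" and "P j"
    and "\<And>k l. k \<in> V \<Longrightarrow> l \<in> neighbors H k \<Longrightarrow> P l \<Longrightarrow> P k"
  shows "P i"
proof -
  have "(i, j) \<in> (adjacency H)\<^sup>*" using connected assms(1,2) unfolding connected_graph_def by blast
  then show ?thesis
  proof (induction rule: converse_rtrancl_induct)
    case base
    show ?case by fact
  next
    case (step k l)
    then have "l \<in> neighbors H k" by (simp add: adjacency_def neighbors_def)
    moreover have "k \<in> V" using calculation neighbors_sym neighbors_subset by blast
    ultimately show ?case using step assms(4) by blast
  qed
qed

lemma neighbors_nonempty: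
  assumes "i \<in> V" shows "neighbors H i \<noteq> {}"
proof -
  obtain e where e: "e \<in> edges H" using edge by auto
  then obtain a b where ab: "e = {a, b}" "a \<noteq> b" using edge_card card_2_iff by metis
  then obtain j where j: "j \<in> V" "j \<noteq> i" using edge_subset[OF e] by auto
  \<comment> \<open>The disjunction makes the induction immediate: \<open>j\<close> satisfies the
    left side, and any vertex before it on the path has a neighbour.\<close>
  have "i = j \<or> neighbors H i \<noteq> {}"
    using assms j(1) by (induction i rule: connected_induct) auto
  then show ?thesis using j by auto
qed

lemma deg_pos: "i \<in> V \<Longrightarrow> deg i > 0"
  unfolding degree_def using neighbors_nonempty finite_neighbors by (simp add: card_gt_0_iff)

text \<open>Double counting of incidences between vertices and edges.\<close>

lemma sum_deg: "(\<Sum>i\<in>V. deg i) = 2 * m"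
proof -
  have d: "degree H i = card {e \<in> edges H. i \<in> e}" for i
  proof -
    have "{e \<in> edges H. i \<in> e} = (\<lambda>j. {i, j}) ` neighbors H i"
    proof (intro equalityI subsetI)
      fix e assume e: "e \<in> {e \<in> edges H. i \<in> e}"
      then obtain a b where "e = {a, b}" "a \<noteq> b" using edge_card card_2_iff by (metis mem_Collect_eq)
      then show "e \<in> (\<lambda>j. {i, j}) ` neighbors H i" using e
        unfolding neighbors_def by (auto simp: insert_commute)
    qed (auto simp: neighbors_def)
    moreover have "inj_on (\<lambda>j. {i, j}) (neighbors H i)"
      by (intro inj_onI) (auto simp: doubleton_eq_iff)
    ultimately show ?thesis by (simp add: degree_def card_image)
  qed
  have "(\<Sum>i\<in>V. card {e \<in> edges H. i \<in> e}) = 2 * card (edges H)"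
  proof (rule sum_multicount[OF finite_verts finite_edges], intro ballI)
    fix e assume "e \<in> edges H"
    then have "{i \<in> V. i \<in> e} = e" using edge_subset by auto
    then show "card {i \<in> V. i \<in> e} = 2" using edge_card \<open>e \<in> edges H\<close> by simp
  qed
  then have "(\<Sum>i\<in>V. degree H i) = 2 * card (edges H)" by (simp add: d)
  then have "real (\<Sum>i\<in>V. degree H i) = real (2 * card (edges H))" by (rule arg_cong)
  then show ?thesis by simp
qed

section \<open>Self-adjointness and harmonic functions\<close>

lemma laplacian_sym: "laplacian H i j = laplacian H j i"
  by (auto simp: laplacian_def insert_commute)

lemma lap_eq: "lap H u i = deg i * u i - (\<Sum>k\<in>neighbors H i. u k)"
  by (simp add: lap_def sum_subtractf degree_def)

lemma lap_laplacian:
  assumes "i \<in> V"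
  shows "lap H u i = (\<Sum>k\<in>V. laplacian H i k * u k)"
proof -
  have "(\<Sum>k\<in>V. laplacian H i k * u k)
      = deg i * u i + (\<Sum>k\<in>V - {i}. if k \<in> neighbors H i then - u k else 0)"
    using finite_verts assms
    by (subst sum.remove[of _ i]) (auto intro!: sum.cong simp: laplacian_def neighbors_def split: if_splits)
  also have "(\<Sum>k\<in>V - {i}. if k \<in> neighbors H i then - u k else 0)
      = (\<Sum>k\<in>neighbors H i. - u k)"
    using finite_verts neighbors_subset neighbors_irrefl
    by (subst sum.inter_restrict[symmetric]) (auto intro!: sum.cong)
  finally show ?thesis by (simp add: lap_eq sum_negf)
qed

lemma lap_self_adjoint: "(\<Sum>i\<in>V. f i * lap H g i) = (\<Sum>i\<in>V. g i * lap H f i)"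
proof -
  have "(\<Sum>i\<in>V. f i * lap H g i) = (\<Sum>i\<in>V. \<Sum>k\<in>V. f i * laplacian H i k * g k)"
    by (simp add: lap_laplacian sum_distrib_left mult.assoc)
  also have "\<dots> = (\<Sum>k\<in>V. \<Sum>i\<in>V. f i * laplacian H i k * g k)" by (rule sum.swap)
  also have "\<dots> = (\<Sum>k\<in>V. \<Sum>i\<in>V. g k * (laplacian H k i * f i))"
    by (intro sum.cong refl) (simp add: laplacian_sym)
  also have "\<dots> = (\<Sum>i\<in>V. g i * lap H f i)" by (simp add: lap_laplacian sum_distrib_left)
  finally show ?thesis .
qed

lemma lap_const: "lap H (\<lambda>_. c) i = 0"
  by (simp add: lap_def)

lemma lap_add: "lap H (\<lambda>x. f x + g x) i = lap H f i + lap H g i"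
  by (simp add: lap_def sum.distrib[symmetric] algebra_simps)

lemma lap_diff: "lap H (\<lambda>x. f x - g x) i = lap H f i - lap H g i"
  by (simp add: lap_def sum_subtractf[symmetric] algebra_simps)

lemma lap_cmult: "lap H (\<lambda>x. c * f x) i = c * lap H f i"
  by (simp add: lap_def sum_distrib_left algebra_simps)

lemma lap_sum: "lap H (\<lambda>x. \<Sum>a\<in>A. f a x) i = (\<Sum>a\<in>A. lap H (f a) i)"
  unfolding lap_def by (subst sum.swap) (simp add: sum_subtractf)

lemmas lap_linear = lap_const lap_add lap_diff lap_cmult lap_sum

lemma sum_lap: "(\<Sum>i\<in>V. lap H u i) = 0"
  using lap_self_adjoint[of "\<lambda>_. 1" u] by (simp add: lap_const)

text \<open>Maximum principle: the set where a harmonic function is maximal is closed under adjacency.\<close>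

lemma harmonic_const:
  assumes harm: "\<And>i. i \<in> V \<Longrightarrow> lap H u i = 0" and i: "i \<in> V" and j: "j \<in> V"
  shows "u i = u j"
proof -
  define M where "M = Max (u ` V)"
  have le: "u k \<le> M" if "k \<in> V" for k unfolding M_def using that finite_verts by simp
  obtain x where x: "x \<in> V" "u x = M"
    unfolding M_def using Max_in[of "u ` V"] finite_verts i by (metis empty_iff finite_imageI imageE image_is_empty)
  have "u k = M" if "k \<in> V" for k
    using that x(1)
  proof (induction k rule: connected_induct)
    case base
    show ?case by fact
  next
    case (step k l)
    have l: "l \<in> V" and kl: "k \<in> neighbors H l"
      using step neighbors_subset neighbors_sym by blast+
    have "(\<Sum>k\<in>neighbors H l. M - u k) = 0"
      using harm[OF l] step.IH by (simp add: lap_def)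
    then have "M - u k = 0"
      using sum_nonneg_eq_0_iff[of "neighbors H l" "\<lambda>k. M - u k"] finite_neighbors kl le
        neighbors_subset by force
    then show ?case by simp
  qed
  then show ?thesis using i j by simp
qed

section \<open>Hitting times\<close>

text \<open>Finite support allows the expectation over the first step to be expanded as a finite
  sum.\<close>

lemma finite_random_walk: "i \<in> V \<Longrightarrow> finite (set_pmf (random_walk H i n))"
proof (induction n arbitrary: i)
  case (Suc n)
  then show ?case using neighbors_subset finite_neighbors neighbors_nonempty by auto
qed simp

lemma hitting_prob_0: "hitting_prob H i j 0 = (if i = j then 1 else 0)"
  by (simp add: hitting_prob_def)

lemma hitting_prob_Suc:
  assumes i: "i \<in> V"
  shows "hitting_prob H i j (Suc n) =
    (if i = j then 0 else (\<Sum>k\<in>neighbors H i. hitting_prob H k j n) / deg i)"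
proof -
  let ?S = "{xs. xs ! Suc n = j \<and> (\<forall>k<Suc n. xs ! k \<noteq> j)}"
  \<comment> \<open>Prepending \<open>i\<close> delays every visit by one step; if
    \<open>i = j\<close>, the target is already visited at time 0 and no later first visit
    remains.\<close>
  have vim: "(#) i -` ?S = (if i = j then {} else {xs. xs ! n = j \<and> (\<forall>k<n. xs ! k \<noteq> j)})"
    by (auto simp: less_Suc_eq_0_disj)
  have "hitting_prob H i j (Suc n) = measure_pmf.expectation (random_walk H i (Suc n)) (indicator ?S)"
    by (simp add: hitting_prob_def)
  also have "\<dots> = (\<Sum>k\<in>neighbors H i.
      measure_pmf.expectation (map_pmf ((#) i) (random_walk H k n)) (indicator ?S) / deg i)"
    unfolding random_walk.simps
    using finite_neighbors neighbors_nonempty[OF i] finite_random_walk subsetD[OF neighbors_subset]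
    by (subst pmf_expectation_bind_pmf_of_set) (auto simp: degree_def divide_inverse mult.commute)
  also have "\<dots> = (\<Sum>k\<in>neighbors H i. measure_pmf.prob (random_walk H k n) ((#) i -` ?S) / deg i)"
    by simp
  also have "\<dots> = (if i = j then 0 else (\<Sum>k\<in>neighbors H i. hitting_prob H k j n) / deg i)"
    unfolding vim by (simp add: hitting_prob_def sum_divide_distrib)
  finally show ?thesis .
qed

section \<open>Almost sure hitting and convergence of the hitting time series\<close>

lemma hitting_prob_nonneg: "hitting_prob H i j n \<ge> 0"
  by (simp add: hitting_prob_def)

text \<open>The tail probability that the walk from \<open>i\<close> has not met \<open>j\<close> up
  to and including time \<open>n\<close>. The starting vertex comes last, so that
  \<open>avoid j n\<close> is a function on vertices.\<close>

definition avoid :: "'a \<Rightarrow> nat \<Rightarrow> 'a \<Rightarrow> real" where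
  "avoid j n i = 1 - (\<Sum>k\<le>n. hitting_prob H i j k)"

lemma avoid_0: "avoid j 0 i = (if i = j then 0 else 1)"
  by (simp add: avoid_def hitting_prob_0)

lemma avoid_Suc:
  assumes i: "i \<in> V"
  shows "avoid j (Suc n) i = (if i = j then 0 else (\<Sum>k\<in>neighbors H i. avoid j n k) / deg i)"
proof (cases "i = j")
  case True
  have "(\<Sum>k\<le>Suc n. hitting_prob H i j k) = 1"
    using True i by (simp add: sum.atMost_Suc_shift hitting_prob_0 hitting_prob_Suc del: sum.atMost_Suc)
  then show ?thesis using True by (simp add: avoid_def)
next
  case False
  have "(\<Sum>k\<le>Suc n. hitting_prob H i j k) =
      (\<Sum>l\<in>neighbors H i. \<Sum>k\<le>n. hitting_prob H l j k) / deg i"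
    using False i
    by (subst sum.swap) (simp add: sum.atMost_Suc_shift hitting_prob_0 hitting_prob_Suc
        sum_divide_distrib[symmetric] del: sum.atMost_Suc)
  then show ?thesis using False deg_pos[OF i]
    by (simp add: avoid_def sum_subtractf degree_def field_simps)
qed

lemma avoid_target: "j \<in> V \<Longrightarrow> avoid j n j = 0"
  by (cases n) (simp_all add: avoid_0 avoid_Suc)

lemma avoid_nonneg: "i \<in> V \<Longrightarrow> avoid j n i \<ge> 0"
proof (induction n arbitrary: i)
  case (Suc n)
  then show ?case using neighbors_subset
    by (auto simp: avoid_Suc intro!: divide_nonneg_nonneg sum_nonneg)
qed (simp add: avoid_0)

lemma avoid_le_1: "avoid j n i \<le> 1"
  by (simp add: avoid_def sum_nonneg hitting_prob_nonneg)

lemma avoid_antimono: "n \<le> n' \<Longrightarrow> avoid j n' i \<le> avoid j n i"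
  unfolding avoid_def using hitting_prob_nonneg by (auto intro!: sum_mono2)

text \<open>Each start reaches \<open>j\<close> with positive probability by some time; tails
  decrease in time and there are finitely many starts, so one time \<open>N\<close> and one bound
  \<open>c\<close> serve all.\<close>

lemma avoid_uniform:
  assumes j: "j \<in> V"
  obtains N c where "0 \<le> c" "c < 1" "\<And>i. i \<in> V \<Longrightarrow> avoid j N i \<le> c"
proof -
  have "\<exists>n. avoid j n i < 1" if "i \<in> V" for i
    using that j
  proof (induction i rule: connected_induct)
    case base
    show ?case using avoid_target[OF j] by (intro exI[of _ 0]) simp
  next
    case (step k l)
    then obtain n where n: "avoid j n l < 1" by auto
    \<comment> \<open>The index set belongs to the fixed vertex \<open>k\<close>, which the
      summation variable shadows. Every term is at most 1, and the one at \<open>l\<close> is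
      strictly smaller.\<close>
    have "(\<Sum>k\<in>neighbors H k. avoid j n k) < (\<Sum>k\<in>neighbors H k. 1)"
      using step n avoid_le_1 finite_neighbors by (intro sum_strict_mono_ex1) auto
    then have "avoid j (Suc n) k < 1"
      using deg_pos[OF step(1)] step(1) by (simp add: avoid_Suc degree_def field_simps)
    then show ?case by blast
  qed
  then obtain n where n: "\<And>i. i \<in> V \<Longrightarrow> avoid j (n i) i < 1" by metis
  define N where "N = Max (n ` V)"
  define c where "c = Max ((\<lambda>i. avoid j N i) ` V)"
  have less: "avoid j N i < 1" if "i \<in> V" for i
  proof -
    have "n i \<le> N" unfolding N_def using that finite_verts by simp
    then show ?thesis using n[OF that] avoid_antimono le_less_trans by blast
  qed
  have le: "avoid j N i \<le> c" if "i \<in> V" for i unfolding c_def using that finite_verts by simp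
  have "c < 1" unfolding c_def using finite_verts j less by (subst Max_less_iff) auto
  moreover have "0 \<le> c" using le[OF j] avoid_target[OF j] by simp
  ultimately show ?thesis using that le by blast
qed

lemma summable_avoid:
  assumes j: "j \<in> V" and i: "i \<in> V"
  shows "summable (\<lambda>n. avoid j n i)"
proof -
  obtain N c where c: "0 \<le> c" "c < 1" and N: "\<And>i. i \<in> V \<Longrightarrow> avoid j N i \<le> c"
    using avoid_uniform[OF j] by metis
  \<comment> \<open>A further \<open>N\<close> steps cost a factor \<open>c\<close>. The base case
    needs \<open>avoid j 0\<close> to be 1 off \<open>j\<close> and 0 at \<open>j\<close>; the
    recursion is linear, so it preserves the bound.\<close>
  have step: "avoid j (n + N) i \<le> c * avoid j n i" if "i \<in> V" for n i
    using that
  proof (induction n arbitrary: i)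
    case 0
    then show ?case using N avoid_target by (auto simp: avoid_0)
  next
    case (Suc n)
    have "(\<Sum>k\<in>neighbors H i. avoid j (n + N) k) \<le> (\<Sum>k\<in>neighbors H i. c * avoid j n k)"
      using Suc neighbors_subset by (intro sum_mono) blast
    then show ?case using Suc.prems deg_pos[OF Suc.prems]
      by (simp add: avoid_Suc divide_right_mono sum_distrib_left)
  qed
  \<comment> \<open>For the partial sums \<open>S n\<close> this gives \<open>S n\<close> \<le>
    \<open>S (n + N)\<close> \<le> \<open>N + c * S n\<close>, to be solved for
    \<open>S n\<close>.\<close>
  have "(\<Sum>k<n. avoid j k i) \<le> N / (1 - c)" for n
  proof -
    have "(\<Sum>k<n. avoid j k i) \<le> (\<Sum>k<n + N. avoid j k i)"
      using i avoid_nonneg by (intro sum_mono2) auto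
    also have "\<dots> = (\<Sum>k<N. avoid j k i) + (\<Sum>k<n. avoid j (k + N) i)"
      by (induction n) simp_all
    also have "\<dots> \<le> (\<Sum>k<N. 1) + (\<Sum>k<n. c * avoid j k i)"
      using step[OF i] avoid_le_1 by (intro add_mono sum_mono) auto
    finally show ?thesis using c by (simp add: sum_distrib_left[symmetric] field_simps)
  qed
  then show ?thesis using avoid_nonneg[OF i] by (intro summableI_nonneg_bounded)
qed

lemma hitting_prob_sums:
  assumes "j \<in> V" "i \<in> V"
  shows "hitting_prob H i j sums 1"
proof -
  have "(\<lambda>n. avoid j n i) \<longlonglongrightarrow> 0" using summable_avoid[OF assms] by (rule summable_LIMSEQ_zero)
  then have "(\<lambda>n. 1 - avoid j n i) \<longlonglongrightarrow> 1 - 0" by (intro tendsto_intros)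
  then show ?thesis by (simp add: sums_def_le avoid_def)
qed

text \<open>Convergence has to be established before the series defining \<open>hitting_time\<close>
  can be manipulated; the tails dominate it.\<close>

lemma hitting_time_sums:
  assumes j: "j \<in> V" and i: "i \<in> V"
  shows "(\<lambda>n. real n * hitting_prob H i j n) sums ht j i"
proof -
  \<comment> \<open>Summation by parts, each hitting probability being a difference of consecutive
    tails. The boundary term has a favourable sign and is dropped below.\<close>
  have parts: "(\<Sum>n<Suc N. real n * hitting_prob H i j n)
      = (\<Sum>n<N. avoid j n i) - N * avoid j N i" for N
  proof (induction N)
    case (Suc N)
    have "hitting_prob H i j (Suc N) = avoid j N i - avoid j (Suc N) i" by (simp add: avoid_def)
    then have "real (Suc N) * hitting_prob H i j (Suc N)
        = real (Suc N) * avoid j N i - real (Suc N) * avoid j (Suc N) i"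
      by (simp only: right_diff_distrib)
    then show ?case using Suc by (simp add: algebra_simps)
  qed simp
  have "(\<Sum>n<N. real n * hitting_prob H i j n) \<le> (\<Sum>n. avoid j n i)" for N
  proof -
    have "(\<Sum>n<N. real n * hitting_prob H i j n) \<le> (\<Sum>n<Suc N. real n * hitting_prob H i j n)"
      by (simp add: hitting_prob_nonneg)
    also have "\<dots> \<le> (\<Sum>n<N. avoid j n i)" using parts avoid_nonneg[OF i] by simp
    also have "\<dots> \<le> (\<Sum>n. avoid j n i)"
      using summable_avoid[OF j i] avoid_nonneg[OF i] by (intro sum_le_suminf) auto
    finally show ?thesis .
  qed
  then have "summable (\<lambda>n. real n * hitting_prob H i j n)"
    using hitting_prob_nonneg by (intro summableI_nonneg_bounded) auto
  then show ?thesis unfolding hitting_time_def by (rule summable_sums)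
qed

section \<open>First-step equations and Kemeny's constant\<close>

lemma ht_self:
  assumes "j \<in> V" shows "ht j j = 0"
proof -
  have "real n * hitting_prob H j j n = 0" for n
    using assms by (cases n) (simp_all add: hitting_prob_Suc)
  then show ?thesis unfolding hitting_time_def by (simp only: suminf_zero)
qed

lemma ht_step:
  assumes j: "j \<in> V" and i: "i \<in> V" and "i \<noteq> j"
  shows "ht j i = 1 + (\<Sum>k\<in>neighbors H i. ht j k) / deg i"
proof -
  \<comment> \<open>The second summand accounts for the first step taken; it sums to 1 because
    hitting is almost sure.\<close>
  have "(\<lambda>n. (\<Sum>k\<in>neighbors H i. real n * hitting_prob H k j n + hitting_prob H k j n) / deg i)
      sums ((\<Sum>k\<in>neighbors H i. ht j k + 1) / deg i)"
    using neighbors_subset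
    by (intro sums_divide sums_sum sums_add hitting_time_sums hitting_prob_sums j) auto
  also have "(\<lambda>n. (\<Sum>k\<in>neighbors H i. real n * hitting_prob H k j n + hitting_prob H k j n) / deg i)
      = (\<lambda>n. real (Suc n) * hitting_prob H i j (Suc n))"
    using assms by (auto simp: hitting_prob_Suc sum.distrib sum_distrib_left algebra_simps add_divide_distrib)
  finally have "(\<lambda>n. real n * hitting_prob H i j n) sums ((\<Sum>k\<in>neighbors H i. ht j k + 1) / deg i)"
    by (subst (asm) sums_Suc_iff) simp
  then have "ht j i = (\<Sum>k\<in>neighbors H i. ht j k + 1) / deg i"
    using hitting_time_sums[OF j i] sums_unique2 by blast
  then show ?thesis using deg_pos[OF i] by (simp add: sum.distrib degree_def field_simps)
qed

text \<open>Off the target this is the first-step equation times the degree. At the target the value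
  is forced, since a Laplacian image sums to 0 while the degrees sum to
  \<open>2 * m\<close>.\<close>

lemma lap_ht:
  assumes j: "j \<in> V" and i: "i \<in> V"
  shows "lap H (ht j) i = deg i - 2 * m * unit_vec j i"
proof -
  have off: "lap H (ht j) i = deg i" if "i \<in> V" "i \<noteq> j" for i
    using ht_step[OF j that] deg_pos[OF that(1)] by (simp add: lap_eq field_simps)
  show ?thesis
  proof (cases "i = j")
    case True
    have "0 = lap H (ht j) j + (\<Sum>i\<in>V - {j}. lap H (ht j) i)"
      using sum_lap[of "ht j"] finite_verts j by (subst (asm) sum.remove) auto
    also have "(\<Sum>i\<in>V - {j}. lap H (ht j) i) = (\<Sum>i\<in>V - {j}. deg i)" using off by simp
    also have "\<dots> = 2 * m - deg j"
      using finite_verts j by (simp add: sum_diff1 sum_deg)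
    finally show ?thesis using True by (simp add: unit_vec_def)
  next
    case False
    then show ?thesis using off i by (simp add: unit_vec_def)
  qed
qed

lemma ht_unique:
  assumes j: "j \<in> V" and u: "\<And>i. i \<in> V \<Longrightarrow> lap H u i = deg i - 2 * m * unit_vec j i"
    and "u j = 0" and i: "i \<in> V"
  shows "u i = ht j i"
proof -
  have "u i - ht j i = u j - ht j j"
    using i j u lap_ht[OF j] by (intro harmonic_const[where u = "\<lambda>x. u x - ht j x"]) (auto simp: lap_diff)
  then show ?thesis using assms ht_self by simp
qed

text \<open>Makes the definite description in \<open>kemeny\<close> usable, for a starting vertex of
  choice: the weighted sum is harmonic in the start, hence constant.\<close>

lemma kemeny_eq:
  assumes i: "i \<in> V"
  shows "kemeny H = (\<Sum>j\<in>V. stationary H j * ht j i)"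
proof -
  let ?F = "\<lambda>i. \<Sum>j\<in>V. stationary H j * ht j i"
  have "lap H ?F k = 0" if k: "k \<in> V" for k
  proof -
    have "lap H ?F k = (\<Sum>j\<in>V. stationary H j * (deg k - 2 * m * unit_vec j k))"
      using k by (simp add: lap_sum lap_cmult lap_ht)
    also have "\<dots> = (\<Sum>j\<in>V. stationary H j) * deg k - (\<Sum>j\<in>V. unit_vec k j * deg j)"
      using m_pos unfolding sum_distrib_right sum_subtractf[symmetric]
      by (intro sum.cong) (auto simp: stationary_def unit_vec_def field_simps)
    also have "(\<Sum>j\<in>V. stationary H j) = 1"
      using m_pos by (simp add: stationary_def sum_divide_distrib[symmetric] sum_deg)
    finally show ?thesis using sum_unit_vec[OF finite_verts k] by simp
  qed
  then have const: "?F i = ?F k" if "k \<in> V" for k using i that by (rule harmonic_const)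
  show ?thesis unfolding kemeny_def
  proof (rule the_equality)
    show "\<forall>k\<in>V. ?F i = ?F k" using const by blast
    show "c = ?F i" if "\<forall>k\<in>V. c = ?F k" for c using that i by blast
  qed
qed

section \<open>Effective resistance\<close>

text \<open>The degree terms of \<open>lap_ht\<close> cancel in the difference, leaving a unit
  current that enters at \<open>a\<close> and leaves at \<open>b\<close>.\<close>

lemma potential_exists:
  assumes "a \<in> V" "b \<in> V" "i \<in> V"
  shows "lap H (\<lambda>x. 1 / (2 * m) * (ht b x - ht a x)) i = unit_vec a i - unit_vec b i"
  using assms m_pos unfolding lap_cmult lap_diff by (simp add: lap_ht field_simps)

text \<open>Exhibits a Green function \<open>X\<close> for which both products with the Laplacian
  are the orthogonal projection \<open>I - J / n\<close> onto the vectors of sum zero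
  (\<open>J\<close> the all-ones matrix). Existence and uniqueness together justify the definite
  description.\<close>

lemma laplacian_pseudoinverse:
  "is_pseudoinverse V (laplacian H) (pseudoinverse V (laplacian H))"
proof -
  define n where "n = real (card V)"
  have V: "V \<noteq> {}" using connected unfolding connected_graph_def by auto
  have n: "n > 0" unfolding n_def using V finite_verts by (simp add: card_gt_0_iff)
  \<comment> \<open>Averaging the potential over all sinks \<open>b\<close> spreads the outgoing
    current evenly; removing the mean in \<open>f\<close> then gives a column of sum zero.\<close>
  define g where "g a x = 1 / n * (\<Sum>b\<in>V. 1 / (2 * m) * (ht b x - ht a x))" for a x
  define f where "f a x = g a x - 1 / n * (\<Sum>y\<in>V. g a y)" for a x
  define X where "X k a = (if k \<in> V \<and> a \<in> V then f a k else 0)" for k a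
  have sf: "(\<Sum>x\<in>V. f a x) = 0" for a
    using n by (simp add: f_def sum_subtractf n_def[symmetric])
  have lf: "lap H (f a) i = unit_vec a i - 1 / n" if "a \<in> V" "i \<in> V" for a i
  proof -
    have "lap H (f a) i = 1 / n * (\<Sum>b\<in>V. unit_vec a i - unit_vec b i)"
      unfolding f_def g_def lap_diff lap_const lap_cmult[of "1 / n"] lap_sum
      using that by (simp only: potential_exists diff_0_right cong: sum.cong)
    also have "(\<Sum>b\<in>V. unit_vec a i - unit_vec b i) = n * unit_vec a i - (\<Sum>b\<in>V. unit_vec i b * 1)"
      by (simp add: sum_subtractf n_def unit_vec_def eq_commute)
    also have "(\<Sum>b\<in>V. unit_vec i b * 1) = 1" using sum_unit_vec[OF finite_verts that(2)] .
    finally show ?thesis using n by (simp add: field_simps)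
  qed
  \<comment> \<open>As \<open>f a\<close> has sum zero, pairing it with \<open>lap H (f b)\<close>
    evaluates it at \<open>b\<close>; self-adjointness exchanges the roles of \<open>a\<close> and
    \<open>b\<close>.\<close>
  have fsym: "f a b = f b a" if "a \<in> V" "b \<in> V" for a b
  proof -
    have *: "(\<Sum>i\<in>V. f a i * lap H (f b) i) = f a b" if "a \<in> V" "b \<in> V" for a b
    proof -
      have "(\<Sum>i\<in>V. f a i * lap H (f b) i) = (\<Sum>i\<in>V. unit_vec b i * f a i) - 1 / n * (\<Sum>i\<in>V. f a i)"
        using that unfolding sum_distrib_left sum_subtractf[symmetric]
        by (intro sum.cong) (simp_all add: lf algebra_simps)
      then show ?thesis using sf sum_unit_vec[OF finite_verts that(2)] by simp
    qed
    show ?thesis using *[OF that] *[OF that(2,1)] lap_self_adjoint by metis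
  qed
  have Xsym: "X i j = X j i" for i j using fsym by (auto simp: X_def)
  have LX: "mat_prod V (laplacian H) X i j = unit_vec j i - 1 / n" if "i \<in> V" "j \<in> V" for i j
    using that lf[of j i] by (simp add: mat_prod_def lap_laplacian X_def)
  have XL: "mat_prod V X (laplacian H) i j = unit_vec j i - 1 / n" if "i \<in> V" "j \<in> V" for i j
  proof -
    have "mat_prod V X (laplacian H) i j = mat_prod V (laplacian H) X j i"
      unfolding mat_prod_def by (intro sum.cong) (simp_all add: Xsym[of i] laplacian_sym[of j])
    then show ?thesis using LX[OF that(2,1)] by (auto simp: unit_vec_def)
  qed
  \<comment> \<open>The projection fixes columns of sum zero, such as those of the Laplacian and of
    \<open>X\<close>; this gives the first two Penrose conditions.\<close>
  have proj: "mat_prod V A B i j = B i j"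
    if "i \<in> V" and A: "\<And>k. k \<in> V \<Longrightarrow> A i k = unit_vec k i - 1 / n" and B: "(\<Sum>k\<in>V. B k j) = 0"
    for A B i j
  proof -
    have "mat_prod V A B i j = (\<Sum>k\<in>V. unit_vec i k * B k j) - 1 / n * (\<Sum>k\<in>V. B k j)"
      unfolding mat_prod_def sum_distrib_left sum_subtractf[symmetric]
      by (intro sum.cong) (auto simp: A unit_vec_def algebra_simps)
    then show ?thesis using B sum_unit_vec[OF finite_verts that(1)] by simp
  qed
  have sX: "(\<Sum>k\<in>V. X k j) = 0" if "j \<in> V" for j using sf[of j] that by (simp add: X_def)
  have sL: "(\<Sum>k\<in>V. laplacian H k j) = 0" if "j \<in> V" for j
    using lap_laplacian[OF that, of "\<lambda>_. 1"] by (simp add: lap_const laplacian_sym[of j])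
  have "is_pseudoinverse V (laplacian H) X"
    unfolding is_pseudoinverse_def
  proof (intro conjI allI ballI impI)
    fix i j assume "i \<notin> V \<or> j \<notin> V"
    then show "X i j = 0" by (auto simp: X_def)
  next
    fix i j assume ij: "i \<in> V" "j \<in> V"
    show "mat_prod V (mat_prod V (laplacian H) X) (laplacian H) i j = laplacian H i j"
      using ij LX sL by (intro proj)
    show "mat_prod V (mat_prod V X (laplacian H)) X i j = X i j"
      using ij XL sX by (intro proj)
    show "mat_prod V (laplacian H) X i j = mat_prod V (laplacian H) X j i"
      using ij by (simp add: LX unit_vec_def)
    show "mat_prod V X (laplacian H) i j = mat_prod V X (laplacian H) j i"
      using ij by (simp add: XL unit_vec_def)
  qed
  then show ?thesis using pseudoinverse_eqI by metis
qed

text \<open>Since \<open>e_i - e_j = L f\<close>, the quadratic form is \<open>f^T L X L f\<close>,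
  which the first Penrose condition reduces to \<open>f^T L f = f^T (e_i - e_j)\<close>.\<close>

lemma resistance_potential:
  assumes i: "i \<in> V" and j: "j \<in> V"
    and f: "\<And>k. k \<in> V \<Longrightarrow> lap H f k = unit_vec i k - unit_vec j k"
  shows "resistance H i j = f i - f j"
proof -
  let ?L = "laplacian H" and ?X = "pseudoinverse V (laplacian H)"
  have fL: "unit_vec i k - unit_vec j k = (\<Sum>a\<in>V. f a * ?L a k)" if "k \<in> V" for k
    using f[OF that] lap_laplacian[OF that, of f] laplacian_sym[of k] by (simp add: mult.commute)
  have Lf: "unit_vec i k - unit_vec j k = (\<Sum>a\<in>V. ?L k a * f a)" if "k \<in> V" for k
    using f[OF that] lap_laplacian[OF that, of f] by simp
  have "resistance H i j
      = (\<Sum>l\<in>V. \<Sum>k\<in>V. (\<Sum>a\<in>V. f a * ?L a k) * ?X k l * (\<Sum>b\<in>V. ?L l b * f b))"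
    unfolding resistance_def by (subst sum.swap) (intro sum.cong, simp_all add: fL[symmetric] Lf[symmetric])
  \<comment> \<open>Row and column vectors become matrices constant in one index, so that
    \<open>mat_prod_assoc\<close> applies; the outer indices \<open>i i\<close> are
    arbitrary.\<close>
  also have "\<dots> = mat_prod V (mat_prod V (mat_prod V (\<lambda>_. f) ?L) ?X) (mat_prod V ?L (\<lambda>k _. f k)) i i"
    by (simp add: mat_prod_def sum_distrib_right)
  also have "\<dots> = mat_prod V (\<lambda>_. f) (mat_prod V (mat_prod V (mat_prod V ?L ?X) ?L) (\<lambda>k _. f k)) i i"
    by (simp add: mat_prod_assoc)
  also have "\<dots> = mat_prod V (\<lambda>_. f) (mat_prod V ?L (\<lambda>k _. f k)) i i"
    using laplacian_pseudoinverse unfolding is_pseudoinverse_def by (intro mat_prod_cong) auto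
  also have "\<dots> = (\<Sum>k\<in>V. unit_vec i k * f k) - (\<Sum>k\<in>V. unit_vec j k * f k)"
    unfolding mat_prod_def sum_subtractf[symmetric]
    by (intro sum.cong) (simp_all add: Lf[symmetric] right_diff_distrib left_diff_distrib)
  finally show ?thesis using sum_unit_vec[OF finite_verts i] sum_unit_vec[OF finite_verts j] by simp
qed

lemma resistance_commute_time:
  assumes "i \<in> V" "j \<in> V"
  shows "resistance H i j = (ht j i + ht i j) / (2 * m)"
  using resistance_potential[OF assms potential_exists[OF assms]] assms ht_self
  by (simp add: add_divide_distrib)

lemma moment_eq:
  assumes v: "v \<in> V"
  shows "moment H v = (\<Sum>i\<in>V. stationary H i * (ht i v + ht v i))"
  unfolding moment_def
  using v by (intro sum.cong) (auto simp: resistance_commute_time stationary_def)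

end

section \<open>One-sums\<close>

text \<open>Unlike \<open>one_sum\<close>, this presentation treats the two summands symmetrically.\<close>

locale gluing = G1: nontrivial_graph G1 + G2: nontrivial_graph G2
  for G1 :: "'a ugraph" and G2 :: "'b ugraph" +
  fixes G :: "'c ugraph" and \<phi> :: "'a \<Rightarrow> 'c" and \<psi> :: "'b \<Rightarrow> 'c" and v :: 'a and w :: 'b
  assumes inj1: "inj_on \<phi> (verts G1)" and inj2: "inj_on \<psi> (verts G2)"
    and v: "v \<in> verts G1" and w: "w \<in> verts G2" and glued: "\<phi> v = \<psi> w"
    and meet: "\<phi> ` verts G1 \<inter> \<psi> ` verts G2 = {\<phi> v}"
    and verts: "verts G = \<phi> ` verts G1 \<union> \<psi> ` verts G2"
    and edges: "edges G = (`) \<phi> ` edges G1 \<union> (`) \<psi> ` edges G2"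
begin

text \<open>Transfers every result about the first summand to the second.\<close>

lemma swap: "gluing G2 G1 G \<psi> \<phi> w v"
  using inj1 inj2 v w glued meet verts edges
  by unfold_locales auto

text \<open>A common edge would lie within the single shared vertex, yet it has two ends.\<close>

lemma edges_disjoint: "(`) \<phi> ` edges G1 \<inter> (`) \<psi> ` edges G2 = {}"
proof (rule ccontr)
  assume "\<not> ?thesis"
  then obtain e e' where e: "e \<in> edges G1" "e' \<in> edges G2" "\<phi> ` e = \<psi> ` e'" by auto
  then have "\<phi> ` e \<subseteq> {\<phi> v}"
    using meet G1.edge_subset[OF e(1)] G2.edge_subset[OF e(2)] by blast
  then have "card (\<phi> ` e) \<le> 1" using card_mono[of "{\<phi> v}"] by fastforce
  moreover have "card (\<phi> ` e) = 2"
    using G1.edge_card[OF e(1)] card_image[OF inj_on_subset[OF inj1 G1.edge_subset[OF e(1)]]] by simp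
  ultimately show False by simp
qed

lemma card_edges: "card (edges G) = card (edges G1) + card (edges G2)"
proof -
  have "inj_on ((`) \<phi>) (edges G1)"
    by (rule inj_on_subset[OF inj_on_image_Pow[OF inj1]]) (use G1.edge_subset in auto)
  moreover have "inj_on ((`) \<psi>) (edges G2)"
    by (rule inj_on_subset[OF inj_on_image_Pow[OF inj2]]) (use G2.edge_subset in auto)
  moreover have "card (edges G) = card ((`) \<phi> ` edges G1) + card ((`) \<psi> ` edges G2)"
    unfolding edges using edges_disjoint G1.finite_edges G2.finite_edges
    by (intro card_Un_disjoint finite_imageI)
  ultimately show ?thesis by (simp add: card_image)
qed

lemma neighbors1:
  assumes x: "x \<in> verts G1"
  shows "neighbors G (\<phi> x) = \<phi> ` neighbors G1 x \<union> (if x = v then \<psi> ` neighbors G2 w else {})"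
proof -
  \<comment> \<open>An edge of the second summand at \<open>\<phi> x\<close> puts
    \<open>\<phi> x\<close> into both images, which meet only in the cut vertex.\<close>
  have xv: "x = v" if y: "{\<phi> x, y} \<in> (`) \<psi> ` edges G2" for y
  proof -
    obtain e where e: "e \<in> edges G2" "{\<phi> x, y} = \<psi> ` e" using y by auto
    then have "\<phi> x \<in> \<psi> ` verts G2" using G2.edge_subset[OF e(1)] by blast
    then have "\<phi> x = \<phi> v" using meet x by blast
    then show ?thesis by (rule inj_onD[OF inj1 _ x v])
  qed
  have "y \<in> neighbors G (\<phi> x) \<longleftrightarrow>
      y \<in> \<phi> ` neighbors G1 x \<or> {\<phi> x, y} \<in> (`) \<psi> ` edges G2" for y
    unfolding neighbors_def[of G] edges mem_Collect_eq Un_iff G1.edge_image_iff[OF inj1 x] ..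
  moreover have "{\<phi> x, y} \<in> (`) \<psi> ` edges G2 \<longleftrightarrow> x = v \<and> y \<in> \<psi> ` neighbors G2 w" for y
    using xv[of y] G2.edge_image_iff[OF inj2 w, of y] unfolding glued[symmetric] by metis
  ultimately show ?thesis by (intro set_eqI) simp
qed

lemma neighbors_disjoint: "\<phi> ` neighbors G1 v \<inter> \<psi> ` neighbors G2 w = {}"
proof (rule equals0I)
  fix z assume z: "z \<in> \<phi> ` neighbors G1 v \<inter> \<psi> ` neighbors G2 w"
  then have "z \<in> \<phi> ` verts G1 \<inter> \<psi> ` verts G2"
    using image_mono[OF G1.neighbors_subset] image_mono[OF G2.neighbors_subset]
    by (meson IntD1 IntD2 IntI subsetD)
  then have "z = \<phi> v" unfolding meet by simp
  then show False
    using z inj_on_image_mem_iff[OF inj1 v G1.neighbors_subset] G1.neighbors_irrefl by simp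
qed

lemma sum_neighbors1:
  assumes x: "x \<in> verts G1"
  shows "(\<Sum>y\<in>neighbors G (\<phi> x). g y) =
    (\<Sum>k\<in>neighbors G1 x. g (\<phi> k)) + (if x = v then \<Sum>k\<in>neighbors G2 w. g (\<psi> k) else 0)"
proof -
  have "inj_on \<phi> (neighbors G1 x)" "inj_on \<psi> (neighbors G2 w)"
    using inj_on_subset[OF inj1 G1.neighbors_subset] inj_on_subset[OF inj2 G2.neighbors_subset]
    by auto
  then show ?thesis
    using neighbors_disjoint G1.finite_neighbors[of x] G2.finite_neighbors[of w]
    unfolding neighbors1[OF x] by (cases "x = v") (simp_all add: sum.union_disjoint sum.reindex)
qed

lemma lap1:
  assumes "x \<in> verts G1"
  shows "lap G u (\<phi> x) = lap G1 (u \<circ> \<phi>) x + (if x = v then lap G2 (u \<circ> \<psi>) w else 0)"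
  by (simp add: lap_def sum_neighbors1[OF assms] glued)

lemma degree1:
  assumes "x \<in> verts G1"
  shows "degree G (\<phi> x) = degree G1 x + (if x = v then degree G2 w else 0)"
  using sum_neighbors1[OF assms, of "\<lambda>_. 1 :: nat"] by (simp add: degree_def)

lemmas lap2 = gluing.lap1[OF swap] and degree2 = gluing.degree1[OF swap]

lemma adjacency_path1:
  assumes "x \<in> verts G1"
  shows "(\<phi> x, \<phi> v) \<in> (adjacency G)\<^sup>*"
  using assms v
proof (induction x rule: G1.connected_induct)
  case (step k l)
  then have "\<phi> l \<in> neighbors G (\<phi> k)" using neighbors1[OF step(1)] by simp
  then have "(\<phi> k, \<phi> l) \<in> adjacency G" by (simp add: adjacency_def neighbors_def)
  then show ?case using step.IH by (rule converse_rtrancl_into_rtrancl)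
qed simp

text \<open>Any two vertices are joined through the cut vertex.\<close>

lemma nontrivial_graph: "nontrivial_graph G"
proof
  show "simple_graph G"
    unfolding simple_graph_def
  proof (intro conjI ballI)
    show "finite (verts G)" by (simp add: verts G1.finite_verts G2.finite_verts)
    fix e assume e: "e \<in> edges G"
    show "e \<subseteq> verts G" 
      using e image_mono[OF G1.edge_subset, of _ \<phi>] image_mono[OF G2.edge_subset, of _ \<psi>]
      unfolding edges verts by (elim UnE imageE) (simp_all add: le_supI1 le_supI2)
    show "card e = 2"
      using e inj_on_subset[OF inj1 G1.edge_subset] inj_on_subset[OF inj2 G2.edge_subset]
      by (auto simp: edges card_image G1.edge_card G2.edge_card)
  qed
  have *: "(x, \<phi> v) \<in> (adjacency G)\<^sup>*" if "x \<in> verts G" for x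
    using that adjacency_path1 gluing.adjacency_path1[OF swap] glued by (auto simp: verts)
  have "sym ((adjacency G)\<^sup>*)"
    by (intro sym_rtrancl symI) (simp add: adjacency_def insert_commute)
  then have "(x, y) \<in> (adjacency G)\<^sup>*" if "x \<in> verts G" "y \<in> verts G" for x y
    using *[OF that(1)] symD[OF _ *[OF that(2)]] by (blast intro: rtrancl_trans)
  then show "connected_graph G" using v by (auto simp: connected_graph_def verts)
  show "edges G \<noteq> {}" using G1.edge by (simp add: edges)
qed

text \<open>From here on the unqualified \<open>V\<close>, \<open>deg\<close>, \<open>m\<close> and
  \<open>ht\<close> refer to the 1-sum.\<close>

sublocale nontrivial_graph G by (rule nontrivial_graph)

text \<open>
  Inside the second summand, the walk towards a vertex \<open>\<phi> j\<close> first has to reach the cut vertex.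
  This contributes an additional flux \<open>2 * G2.m\<close> through the cut vertex, whose potential in the
  first summand is a multiple of \<open>G1.ht j - G1.ht v\<close>.
\<close>

lemma ht_cut_vertex:
  assumes j: "j \<in> verts G1"
  shows "ht (\<phi> j) (\<phi> v) = G1.ht j v + G2.m / G1.m * (G1.ht j v + G1.ht v j)"
proof -
  \<comment> \<open>The Laplacian of \<open>G1.ht j - G1.ht v\<close> is \<open>2 * G1.m\<close>
    times a unit current from \<open>v\<close> to \<open>j\<close>; the factor
    \<open>G2.m / G1.m\<close> rescales it to \<open>2 * G2.m\<close>. The constant
    \<open>G1.ht v j\<close> makes \<open>p j = 0\<close>.\<close>
  define p where "p x = G1.ht j x + G2.m / G1.m * (G1.ht j x - G1.ht v x + G1.ht v j)" for x
  \<comment> \<open>The offset makes \<open>q w = p v\<close>, so the two pieces of \<open>u\<close>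
    agree at the cut vertex.\<close>
  define q where "q y = p v + G2.ht w y" for y
  define u where "u z = (if z \<in> \<phi> ` verts G1 then p (inv_into (verts G1) \<phi> z)
    else q (inv_into (verts G2) \<psi> z))" for z
  have u1: "u (\<phi> x) = p x" if "x \<in> verts G1" for x using that inj1 by (simp add: u_def)
  have u2: "u (\<psi> y) = q y" if y: "y \<in> verts G2" for y
  proof (cases "y = w")
    case True
    then show ?thesis using u1[OF v] G2.ht_self[OF w] by (simp add: glued q_def)
  next
    case False
    then have "\<psi> y \<noteq> \<phi> v" using inj_onD[OF inj2 _ y w] glued by auto
    then have "\<psi> y \<notin> \<phi> ` verts G1" using meet y by blast
    then show ?thesis using inj2 y by (simp add: u_def)
  qed
  have lap_u1: "lap G1 (u \<circ> \<phi>) x =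
      G1.deg x - 2 * G1.m * unit_vec j x + 2 * G2.m * (unit_vec v x - unit_vec j x)"
    if x: "x \<in> verts G1" for x
  proof -
    have "lap G1 (u \<circ> \<phi>) x = lap G1 p x"
      unfolding lap_def using x u1 G1.neighbors_subset by (intro sum.cong) auto
    also have "\<dots> = lap G1 (G1.ht j) x + G2.m / G1.m * (lap G1 (G1.ht j) x - lap G1 (G1.ht v) x)"
      unfolding p_def by (simp only: G1.lap_linear add_0_right)
    also have "\<dots> = G1.deg x - 2 * G1.m * unit_vec j x + 2 * G2.m * (unit_vec v x - unit_vec j x)"
      using x j v G1.m_pos by (simp add: G1.lap_ht field_simps)
    finally show ?thesis .
  qed
  have lap_u2: "lap G2 (u \<circ> \<psi>) y = G2.deg y - 2 * G2.m * unit_vec w y"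
    if y: "y \<in> verts G2" for y
  proof -
    have "lap G2 (u \<circ> \<psi>) y = lap G2 q y"
      unfolding lap_def using y u2 G2.neighbors_subset by (intro sum.cong) auto
    also have "\<dots> = lap G2 (G2.ht w) y" unfolding q_def by (simp only: G2.lap_linear add_0_left)
    finally show ?thesis using y w by (simp add: G2.lap_ht)
  qed
  have m: "m = G1.m + G2.m" by (simp add: card_edges)
  have "lap G u z = deg z - 2 * m * unit_vec (\<phi> j) z" if z: "z \<in> V" for z
  proof (cases "z \<in> \<phi> ` verts G1")
    case True
    then obtain x where x: "x \<in> verts G1" "z = \<phi> x" by auto
    have "unit_vec (\<phi> j) (\<phi> x) = unit_vec j x"
      using inj1 x j by (auto simp: unit_vec_def dest: inj_onD)
    \<comment> \<open>At \<open>x = v\<close> the term \<open>- 2 * G2.m\<close> contributed by the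
      second summand cancels the extra flux in \<open>lap_u1\<close>.\<close>
    then show ?thesis
      using x w by (auto simp: lap1 degree1 lap_u1 lap_u2 m unit_vec_def algebra_simps)
  next
    case False
    then obtain y where y: "y \<in> verts G2" "z = \<psi> y" using z by (auto simp: verts)
    have "y \<noteq> w" using False y imageI[OF v, of \<phi>] glued by auto
    moreover have "z \<noteq> \<phi> j" using False j by auto
    ultimately show ?thesis using y by (simp add: lap2 degree2 lap_u2 unit_vec_def)
  qed
  moreover have "u (\<phi> j) = 0" using u1[OF j] G1.ht_self[OF j] by (simp add: p_def)
  moreover have "\<phi> j \<in> V" "\<phi> v \<in> V" using j v by (auto simp: verts)
  ultimately have "u (\<phi> v) = ht (\<phi> j) (\<phi> v)" by (intro ht_unique)
  then show ?thesis using u1[OF v] G1.ht_self[OF v] by (simp add: p_def)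
qed

text \<open>The weights are \<open>2 * G1.m\<close> times the stationary ones. The first term of
  \<open>ht_cut_vertex\<close> then averages to Kemeny's constant started at \<open>v\<close>, the
  commute times to the moment.\<close>

lemma weighted_sum_ht1:
  "(\<Sum>j\<in>verts G1. G1.deg j * ht (\<phi> j) (\<phi> v)) = 2 * (G1.m * kemeny G1 + G2.m * moment G1 v)"
proof -
  have "2 * (G1.m * kemeny G1 + G2.m * moment G1 v) =
      (\<Sum>j\<in>verts G1. 2 * (G1.m * (stationary G1 j * G1.ht j v)
        + G2.m * (stationary G1 j * (G1.ht j v + G1.ht v j))))"
    using v by (simp add: G1.kemeny_eq G1.moment_eq sum_distrib_left sum.distrib)
  also have "\<dots> = (\<Sum>j\<in>verts G1. G1.deg j * ht (\<phi> j) (\<phi> v))"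
    using G1.m_pos by (intro sum.cong) (auto simp: ht_cut_vertex stationary_def field_simps)
  finally show ?thesis by simp
qed

text \<open>The cut vertex is counted twice on the right and its degree differs from those in the
  summands; neither matters as \<open>g\<close> vanishes there.\<close>

lemma sum_deg_split:
  assumes "g (\<phi> v) = 0"
  shows "(\<Sum>z\<in>V. deg z * g z) =
    (\<Sum>x\<in>verts G1. G1.deg x * g (\<phi> x)) + (\<Sum>y\<in>verts G2. G2.deg y * g (\<psi> y))"
proof -
  have "(\<Sum>z\<in>V. deg z * g z) =
      (\<Sum>z\<in>\<phi> ` verts G1. deg z * g z) + (\<Sum>z\<in>\<psi> ` verts G2. deg z * g z)"
    unfolding verts using G1.finite_verts G2.finite_verts meet assms
    by (subst sum.union_inter_neutral) auto
  also have "(\<Sum>z\<in>\<phi> ` verts G1. deg z * g z) = (\<Sum>x\<in>verts G1. G1.deg x * g (\<phi> x))"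
    using inj1 assms by (auto simp: sum.reindex degree1 intro!: sum.cong)
  also have "(\<Sum>z\<in>\<psi> ` verts G2. deg z * g z) = (\<Sum>y\<in>verts G2. G2.deg y * g (\<psi> y))"
    using inj2 assms glued by (auto simp: sum.reindex degree2 intro!: sum.cong)
  finally show ?thesis .
qed

text \<open>Kemeny's constant is evaluated with the walk started at the cut vertex, whose own
  hitting time is 0, so the sum over targets splits into the two summands.\<close>

theorem kemeny_gluing:
  "kemeny G = (G1.m * (kemeny G1 + moment G2 w) + G2.m * (kemeny G2 + moment G1 v)) / (G1.m + G2.m)"
proof -
  have vV: "\<phi> v \<in> V" using v by (auto simp: verts)
  have m: "m = G1.m + G2.m" by (simp add: card_edges)
  have "2 * m * kemeny G = (\<Sum>z\<in>V. deg z * ht z (\<phi> v))"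
    using m_pos by (simp add: kemeny_eq[OF vV] sum_distrib_left stationary_def)
  also have "\<dots> = (\<Sum>x\<in>verts G1. G1.deg x * ht (\<phi> x) (\<phi> v))
      + (\<Sum>y\<in>verts G2. G2.deg y * ht (\<psi> y) (\<psi> w))"
    using ht_self[OF vV] by (simp add: sum_deg_split glued)
  also have "\<dots> = 2 * (G1.m * kemeny G1 + G2.m * moment G1 v)
      + 2 * (G2.m * kemeny G2 + G1.m * moment G2 w)"
    by (simp only: weighted_sum_ht1 gluing.weighted_sum_ht1[OF swap])
  finally have "m * kemeny G =
      G1.m * (kemeny G1 + moment G2 w) + G2.m * (kemeny G2 + moment G1 v)"
    by (simp add: algebra_simps)
  then show ?thesis using m_pos unfolding m by (simp add: field_simps)
qed

end

theorem theorem2p1: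
  fixes G\<^sub>1 :: "'a ugraph" and G\<^sub>2 :: "'b ugraph"
    and v\<^sub>1 :: 'a and v\<^sub>2 :: 'b and G :: "('a + 'b) ugraph" and m\<^sub>1 m\<^sub>2 :: nat
  assumes "simple_graph G\<^sub>1" and "connected_graph G\<^sub>1" and "edges G\<^sub>1 \<noteq> {}"
    and "simple_graph G\<^sub>2" and "connected_graph G\<^sub>2" and "edges G\<^sub>2 \<noteq> {}"
    and "v\<^sub>1 \<in> verts G\<^sub>1" and "v\<^sub>2 \<in> verts G\<^sub>2"
    and "G = one_sum G\<^sub>1 v\<^sub>1 v\<^sub>2 G\<^sub>2"
    and "m\<^sub>1 = card (edges G\<^sub>1)" and "m\<^sub>2 = card (edges G\<^sub>2)"
  shows "card (edges G) = m\<^sub>1 + m\<^sub>2 \<and>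
    kemeny G =
      (real m\<^sub>1 * (kemeny G\<^sub>1 + moment G\<^sub>2 v\<^sub>2) + real m\<^sub>2 * (kemeny G\<^sub>2 + moment G\<^sub>1 v\<^sub>1)) /
      (real m\<^sub>1 + real m\<^sub>2)"
proof -
  interpret gluing G\<^sub>1 G\<^sub>2 G Inl "glue v\<^sub>1 v\<^sub>2" v\<^sub>1 v\<^sub>2
  proof
    show "inj_on (glue v\<^sub>1 v\<^sub>2) (verts G\<^sub>2)"
      by (intro inj_onI) (auto simp: glue_def split: if_splits)
    \<comment> \<open>\<open>glue\<close> yields an \<open>Inl\<close> value only at
      \<open>v\<^sub>2\<close>, so the images meet in the merged vertex alone.\<close>
    show "Inl ` verts G\<^sub>1 \<inter> glue v\<^sub>1 v\<^sub>2 ` verts G\<^sub>2 = {Inl v\<^sub>1}"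
      using assms by (auto simp: glue_def image_iff split: if_splits)
  qed (use assms in \<open>simp_all add: one_sum_def glue_def\<close>)
  show ?thesis using card_edges kemeny_gluing assms by simp
qed

end
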